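(* Let $\mathcal{R}$ be a unital ring with involution, let $m\in\mathcal{R}$ be invertible with $m^*=m$, and let $a,b,ab\in\mathcal{R}^{\mathrm{core},m}$. (i) If $b$ is unitary and $b^*a^{\mathrm{core},m}\mathcal{R}\subseteq a^{\mathrm{core},m}\mathcal{R}$, then $(ab)^{\mathrm{core},m}=b^*a^{\mathrm{core},m}$. (ii) If $a$ is unitary and $a\mathcal{R}\subseteq b\mathcal{R}$, then $(ab)^{\mathrm{core},m}=b^{\mathrm{core},m}a^{*}$.
   Context: $\mathcal{R}$ is a (not necessarily commutative) unital ring with an involution $x\mapsto x^*$ satisfying $(xy)^*=y^*x^*$, $(x+y)^*=x^*+y^*$, $(x^* )^*=x$. An element $u$ is unitary if $uu^*=u^*u=1$. For an invertible $m\in\mathcal{R}$ with $m^*=m$, an element $z\in\mathcal{R}$ is the $m$-weighted core inverse of $a\in\mathcal{R}$ if $aza=a$, $z\mathcal{R}=a\mathcal{R}$ and $\mathcal{R}z=\mathcal{R}a^*m$. It is unique if it exists and is denoted $a^{\mathrm{core},m}$; $\mathcal{R}^{\mathrm{core},m}$ is the set of elements that have an $m$-weighted core inverse. *)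

theory Defs
  imports Main
begin

text \<open>
  Unital rings are rendered by the sort \<open>{ring, monoid_mult}\<close>: unlike \<open>ring_1\<close>, it does
  not assume \<open>0 \<noteq> 1\<close>, so the zero ring is not excluded.
\<close>

definition involution :: "('a::{ring, monoid_mult} \<Rightarrow> 'a) \<Rightarrow> bool" where
  "involution star \<longleftrightarrow>
     (\<forall>x y. star (x * y) = star y * star x) \<and>
     (\<forall>x y. star (x + y) = star x + star y) \<and>
     (\<forall>x. star (star x) = x)"

definition unitary :: "('a::{ring, monoid_mult} \<Rightarrow> 'a) \<Rightarrow> 'a \<Rightarrow> bool" where
  "unitary star u \<longleftrightarrow> u * star u = 1 \<and> star u * u = 1"

definition ring_invertible :: "'a::{ring, monoid_mult} \<Rightarrow> bool" where
  "ring_invertible x \<longleftrightarrow> (\<exists>y. x * y = 1 \<and> y * x = 1)"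

definition right_ideal_of :: "'a::{ring, monoid_mult} \<Rightarrow> 'a set" where
  "right_ideal_of x = {x * r | r. True}"

definition left_ideal_of :: "'a::{ring, monoid_mult} \<Rightarrow> 'a set" where
  "left_ideal_of x = {r * x | r. True}"

definition is_core_inverse ::
    "('a::{ring, monoid_mult} \<Rightarrow> 'a) \<Rightarrow> 'a \<Rightarrow> 'a \<Rightarrow> 'a \<Rightarrow> bool" where
  "is_core_inverse star m a z \<longleftrightarrow>
     a * z * a = a \<and>
     right_ideal_of z = right_ideal_of a \<and>
     left_ideal_of z = left_ideal_of (star a * m)"

definition core_invertible :: "('a::{ring, monoid_mult} \<Rightarrow> 'a) \<Rightarrow> 'a \<Rightarrow> 'a set" where
  "core_invertible star m = {a. \<exists>z. is_core_inverse star m a z}"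

text \<open>
  The value is meaningful only for \<open>a \<in> core_invertible star m\<close> with \<open>m\<close> invertible and
  \<open>star m = m\<close>; uniqueness in that case is lemma \<open>is_core_inverse_unique\<close> below.
\<close>

definition core_inverse ::
    "('a::{ring, monoid_mult} \<Rightarrow> 'a) \<Rightarrow> 'a \<Rightarrow> 'a \<Rightarrow> 'a" where
  "core_inverse star m a = (THE z. is_core_inverse star m a z)"

lemma is_core_inverse_projection:
  fixes star :: "'a::{ring, monoid_mult} \<Rightarrow> 'a"
  assumes inv: "involution star" and n: "m * n = 1" "n * m = 1" and m: "star m = m"
    and z: "is_core_inverse star m a z"
  shows "n * star (a * z) * m = a * z"
proof -
  have mult: "star (x * y) = star y * star x" and ss: "star (star x) = x" for x y
    using inv by (auto simp: involution_def)
  have s1: "star 1 = 1" by (metis mult ss mult_1_left mult_1_right)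
  have sn: "star n = n"
    by (metis mult n m s1 mult.assoc mult_1_left mult_1_right)
  have aza: "a * z * a = a" using z by (simp add: is_core_inverse_def)
  have "1 * z \<in> left_ideal_of z" unfolding left_ideal_of_def by blast
  then have "z \<in> left_ideal_of (star a * m)"
    using z by (simp add: is_core_inverse_def)
  then obtain v where v: "z = v * (star a * m)" by (auto simp: left_ideal_of_def)
  define p where "p = a * z"
  define p' where "p' = n * star p * m"
  have "star a * star p = star a" using aza by (metis p_def mult)
  moreover have "z * p' = v * (star a * ((m * n) * (star p * m)))"
    unfolding v p'_def by (simp only: mult.assoc)
  ultimately have zp': "z * p' = z"
    unfolding n v by (simp add: mult.assoc[symmetric])
  have pp': "p * p' = p" unfolding p_def using zp' by (simp add: mult.assoc p_def)
  have "star p = star p' * star p" using pp' mult by metis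
  also have "star p' = m * p * n" by (simp add: p'_def mult ss m sn mult.assoc)
  finally have "p' = (n * m) * p * (n * star p * m)" unfolding p'_def by (metis mult.assoc)
  then have "p' = p * p'" using n by (simp add: p'_def)
  with pp' show ?thesis by (simp add: p_def p'_def)
qed

lemma is_core_inverse_unique:
  fixes star :: "'a::{ring, monoid_mult} \<Rightarrow> 'a"
  assumes inv: "involution star" and "ring_invertible m" and m: "star m = m"
    and z: "is_core_inverse star m a z" and w: "is_core_inverse star m a w"
  shows "z = w"
proof -
  obtain n where n: "m * n = 1" "n * m = 1" using assms by (auto simp: ring_invertible_def)
  have mult: "star (x * y) = star y * star x" for x y
    using inv by (auto simp: involution_def)
  have R: "\<exists>u. x = y * u" if "right_ideal_of x = right_ideal_of y" for x y :: 'a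
  proof -
    have "x * 1 \<in> right_ideal_of x" unfolding right_ideal_of_def by blast
    with that show ?thesis by (auto simp: right_ideal_of_def)
  qed
  have L: "\<exists>u. x = u * y" if "left_ideal_of x = left_ideal_of y" for x y :: 'a
  proof -
    have "1 * x \<in> left_ideal_of x" unfolding left_ideal_of_def by blast
    with that show ?thesis by (auto simp: left_ideal_of_def)
  qed
  have pz: "n * star (a * z) * m = a * z" and pw: "n * star (a * w) * m = a * w"
    using is_core_inverse_projection[OF inv n m] z w by blast+
  have za: "a * z * a = a" and wa: "a * w * a = a"
    using z w by (auto simp: is_core_inverse_def)
  have "(a * w) * (a * z) = a * z" using wa by (metis mult.assoc)
  then have "n * (star (a * z) * star (a * w)) * m = a * z" using pz mult by metis
  moreover have "n * (star (a * z) * star (a * w)) * m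
      = (n * star (a * z) * m) * (n * star (a * w) * m)"
    using n by (metis mult.assoc mult_1_left)
  ultimately have "(a * z) * (a * w) = a * z" using pz pw by simp
  moreover have "(a * z) * (a * w) = a * w" using za by (metis mult.assoc)
  ultimately have p: "a * z = a * w" by simp
  obtain v where v: "w = v * (star a * m)" using L w is_core_inverse_def by metis
  have "star a * star (a * w) = star a" using wa mult by metis
  then have "w * (n * star (a * w) * m) = w"
    using n unfolding v by (metis mult.assoc mult_1_left)
  then have waw: "w * (a * w) = w" using pw by simp
  obtain s where s: "z = a * s" using R z is_core_inverse_def by metis
  obtain t where t: "a = w * t" using R w is_core_inverse_def by metis
  have "w * a * a = a" using waw t by (metis mult.assoc)
  then have "w * (a * z) = z" using s by (metis mult.assoc)
  with p waw show ?thesis by simp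
qed

end

theory Submission
  imports Defs
begin

text \<open>
  Write \<open>x\<close>, \<open>y\<close> for the core inverses of \<open>a\<close>, \<open>b\<close>. Since the core inverse is unique, each part
  amounts to checking the defining conditions for the proposed candidate, and in each part one
  condition resists a direct check.

  For unitary \<open>b\<close> the difficult condition is \<open>b\<^sup>* x R = a b R\<close>, that is \<open>b\<^sup>* a R = a R\<close>; the
  hypothesis gives only the inclusion from left to right, and in a non-Noetherian ring an
  automorphism may map a submodule properly into itself. What rules this out is the core
  invertibility of \<open>a b\<close>. A core invertible element \<open>c\<close> acts bijectively on \<open>c R\<close> by left
  multiplication (lemmas \<open>core_inverse_mult_square\<close> and \<open>core_invertible_in_square_right_ideal\<close>).
  So \<open>a\<close> maps \<open>a R\<close> onto itself, and \<open>a b\<close> is injective on \<open>a b R = a R\<close>, whence \<open>a\<close> is injective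
  on \<open>b a R\<close>, a module containing \<open>a R\<close>. An element of \<open>b a R\<close> has the same image under \<open>a\<close> as some
  element of \<open>a R\<close>, and therefore equals it: \<open>b a R \<subseteq> a R\<close>.

  For unitary \<open>a\<close> the hypothesis \<open>a R \<subseteq> b R\<close> forces \<open>b R = R\<close>, and then \<open>b\<close> is invertible with
  inverse \<open>y\<close>. The claim becomes the formula for the inverse of a product of units, because the
  core inverse of a unit is its ordinary inverse.
\<close>

lemma right_ideal_of_subset_iff:
  "right_ideal_of x \<subseteq> right_ideal_of y \<longleftrightarrow> (\<exists>r. x = y * r)"
proof
  assume "right_ideal_of x \<subseteq> right_ideal_of y"
  moreover have "x * 1 \<in> right_ideal_of x" unfolding right_ideal_of_def by blast
  ultimately show "\<exists>r. x = y * r" by (auto simp: right_ideal_of_def)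
qed (auto simp: right_ideal_of_def mult.assoc)

lemma left_ideal_of_subset_iff:
  "left_ideal_of x \<subseteq> left_ideal_of y \<longleftrightarrow> (\<exists>r. x = r * y)"
proof
  assume "left_ideal_of x \<subseteq> left_ideal_of y"
  moreover have "1 * x \<in> left_ideal_of x" unfolding left_ideal_of_def by blast
  ultimately show "\<exists>r. x = r * y" by (auto simp: left_ideal_of_def)
next
  assume "\<exists>r. x = r * y"
  then show "left_ideal_of x \<subseteq> left_ideal_of y"
    by (auto simp: left_ideal_of_def mult.assoc[symmetric])
qed

lemma right_ideal_of_eq_iff:
  "right_ideal_of x = right_ideal_of y \<longleftrightarrow> (\<exists>r. x = y * r) \<and> (\<exists>r. y = x * r)"
  by (simp add: set_eq_subset right_ideal_of_subset_iff)

lemma left_ideal_of_eq_iff: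
  "left_ideal_of x = left_ideal_of y \<longleftrightarrow> (\<exists>r. x = r * y) \<and> (\<exists>r. y = r * x)"
  by (simp add: set_eq_subset left_ideal_of_subset_iff)

lemma left_ideal_of_left_invertible:
  assumes "v * u = 1"
  shows "left_ideal_of (u * x) = left_ideal_of x"
proof -
  have "x = v * (u * x)" using assms by (simp add: mult.assoc[symmetric])
  then show ?thesis unfolding left_ideal_of_eq_iff by blast
qed

lemma involution_mult: "involution star \<Longrightarrow> star (x * y) = star y * star x"
  by (simp add: involution_def)

lemma involution_one: "involution star \<Longrightarrow> star 1 = 1"
  unfolding involution_def by (metis mult_1_left mult_1_right)

lemma core_inverse_eqI:
  assumes "involution star" "ring_invertible m" "star m = m" "is_core_inverse star m a z"
  shows "core_inverse star m a = z"
  unfolding core_inverse_def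
  using assms is_core_inverse_unique by (intro the_equality) blast+

lemma is_core_inverse_core_inverse:
  assumes "involution star" "ring_invertible m" "star m = m" "a \<in> core_invertible star m"
  shows "is_core_inverse star m a (core_inverse star m a)"
  using assms core_inverse_eqI by (fastforce simp: core_invertible_def)

text \<open>
  Since \<open>z\<close> lies in \<open>R a\<^sup>* m\<close>, it absorbs on the right the projection \<open>m\<^sup>-\<^sup>1 (a z)\<^sup>* m\<close>, which is
  \<open>a z\<close> itself.
\<close>

lemma core_inverse_reflexive:
  fixes star :: "'a::{ring, monoid_mult} \<Rightarrow> 'a"
  assumes inv: "involution star" and "ring_invertible m" and m: "star m = m"
    and z: "is_core_inverse star m a z"
  shows "z * a * z = z"
proof -
  obtain n where n: "m * n = 1" "n * m = 1" using assms by (auto simp: ring_invertible_def)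
  obtain v where v: "z = v * (star a * m)"
    using z by (auto simp: is_core_inverse_def left_ideal_of_eq_iff)
  have "star a * star (a * z) = star (a * z * a)" by (simp add: involution_mult[OF inv])
  then have absorb: "star a * star (a * z) = star a" using z by (simp add: is_core_inverse_def)
  have "z * (n * star (a * z) * m) = v * (star a * (m * n) * star (a * z) * m)"
    by (subst v) (simp only: mult.assoc)
  also have "\<dots> = z" using absorb n v by simp
  finally show ?thesis
    using is_core_inverse_projection[OF inv n m z] by (simp add: mult.assoc)
qed

text \<open>The element \<open>z\<close> undoes left multiplication by \<open>a\<close> on \<open>a R\<close>, so that map is injective.\<close>

lemma core_inverse_mult_square:
  fixes star :: "'a::{ring, monoid_mult} \<Rightarrow> 'a"
  assumes "involution star" "ring_invertible m" "star m = m" "is_core_inverse star m a z"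
  shows "z * a * a = a"
proof -
  obtain t where "a = z * t"
    using assms(4) by (auto simp: is_core_inverse_def right_ideal_of_eq_iff)
  then show ?thesis using core_inverse_reflexive[OF assms] by (metis mult.assoc)
qed

text \<open>Left multiplication by \<open>a\<close> maps \<open>a R\<close> onto itself.\<close>

lemma core_invertible_in_square_right_ideal:
  assumes "is_core_inverse star m a z"
  shows "\<exists>s. a = a * a * s"
proof -
  obtain s where "z = a * s"
    using assms by (auto simp: is_core_inverse_def right_ideal_of_eq_iff)
  then have "a = a * a * (s * a)" using assms by (simp add: is_core_inverse_def mult.assoc)
  then show ?thesis ..
qed

text \<open>
  This is where core invertibility of the product upgrades an inclusion to an equality: from
  \<open>b\<^sup>-\<^sup>1 a R \<subseteq> a R\<close> it produces the reverse inclusion. The hypotheses keep only what the bijectivity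
  argument consumes: \<open>a\<close> is onto on \<open>a R\<close>, and \<open>a b\<close> is injective on \<open>a R\<close>.
\<close>

lemma right_ideal_invariant_under_inverse:
  fixes a b :: "'a::{ring, monoid_mult}"
  assumes unit: "b * b' = 1" and k: "b' * a = a * k"
    and onto: "a = a * a * s" and inj: "w * (a * b) * a = a"
  shows "b * a = a * (s * b * a)"
proof -
  have a: "a = b * a * k"
    using unit k by (metis mult.assoc mult_1_left)
  \<comment> \<open>The difference of the two sides lies in \<open>b a R\<close>, and \<open>a\<close> kills it.\<close>
  define q where "q = 1 - k * (s * b * a)"
  have diff: "b * a * q = b * a - a * (s * b * a)"
  proof -
    have "b * a * q = b * a - b * a * k * (s * b * a)"
      by (simp add: q_def right_diff_distrib mult.assoc)
    then show ?thesis using a by simp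
  qed
  have "a * (b * a * q) = a * (b * a) - a * a * s * (b * a)"
    unfolding diff by (simp add: right_diff_distrib mult.assoc)
  then have "a * (b * a * q) = 0" using onto by simp
  then have "w * (a * b) * a * q = 0" by (simp add: mult.assoc)
  then have "a * q = 0" using inj by simp
  then have "b * a * q = 0" by (simp add: mult.assoc)
  then show ?thesis using diff by simp
qed

lemma is_core_inverse_mult_unitary_right:
  fixes star :: "'a::{ring, monoid_mult} \<Rightarrow> 'a"
  assumes inv: "involution star" "ring_invertible m" "star m = m"
    and x: "is_core_inverse star m a x"
    and w: "is_core_inverse star m (a * b) w"
    and b: "unitary star b"
    and sub: "right_ideal_of (star b * x) \<subseteq> right_ideal_of x"
  shows "is_core_inverse star m (a * b) (star b * x)"
proof -
  have b1: "b * star b = 1" and b2: "star b * b = 1" using b by (auto simp: unitary_def)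
  have axa: "a * x * a = a" using x by (simp add: is_core_inverse_def)
  obtain s t where s: "x = a * s" and t: "a = x * t"
    using x by (auto simp: is_core_inverse_def right_ideal_of_eq_iff)
  obtain p where "star b * x = x * p" using sub by (auto simp: right_ideal_of_subset_iff)
  then have k: "star b * a = a * (s * p * t)" using s t by (metis mult.assoc)
  have "w * (a * b) * (a * b) = a * b" by (rule core_inverse_mult_square[OF inv w])
  then have "w * (a * b) * (a * b) * star b = a * b * star b" by simp
  then have inj: "w * (a * b) * a = a" using b1 by (simp add: mult.assoc)
  obtain r where onto: "a = a * a * r"
    using core_invertible_in_square_right_ideal[OF x] by blast
  obtain l where "b * a = a * l"
    using right_ideal_invariant_under_inverse[OF b1 k onto inj] by blast
  then have "a = star b * (a * l)" using b2 by (metis mult.assoc mult_1_left)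
  then have "a * b = star b * x * (t * l * b)" using t by (metis mult.assoc)
  moreover have "star b * x = a * b * (star b * (s * p * t) * s)"
  proof -
    have "star b * x = star b * a * s" using s by (simp add: mult.assoc)
    also have "\<dots> = a * (b * star b) * (s * p * t) * s" using k b1 by simp
    finally show ?thesis by (simp add: mult.assoc)
  qed
  ultimately have right: "right_ideal_of (star b * x) = right_ideal_of (a * b)"
    unfolding right_ideal_of_eq_iff by blast
  have "left_ideal_of (star b * x) = left_ideal_of (star b * (star a * m))"
    using x by (simp add: left_ideal_of_left_invertible[OF b1] is_core_inverse_def)
  then have left: "left_ideal_of (star b * x) = left_ideal_of (star (a * b) * m)"
    by (simp add: involution_mult[OF inv(1)] mult.assoc)
  have "a * b * (star b * x) * (a * b) = a * (b * star b) * x * a * b"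
    by (simp only: mult.assoc)
  then have "a * b * (star b * x) * (a * b) = a * b" using b1 axa by simp
  with right left show ?thesis by (simp add: is_core_inverse_def)
qed

text \<open>
  All the one-sided ideals in the definition become the whole ring when the elements are units.
\<close>

lemma is_core_inverse_unit:
  fixes star :: "'a::{ring, monoid_mult} \<Rightarrow> 'a"
  assumes inv: "involution star" and "ring_invertible m"
    and uv: "u * v = 1" and vu: "v * u = 1"
  shows "is_core_inverse star m u v"
proof -
  obtain n where n: "n * m = 1" using assms by (auto simp: ring_invertible_def)
  have "star v * star u = 1"
    using involution_mult[OF inv, of u v] uv involution_one[OF inv] by simp
  then have "left_ideal_of (star u * m) = left_ideal_of m"
    by (rule left_ideal_of_left_invertible)
  also have "\<dots> = left_ideal_of 1"
    using left_ideal_of_left_invertible[OF _ , of n m] n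
    by (auto simp: left_ideal_of_eq_iff)
  also have "\<dots> = left_ideal_of v"
    using uv by (auto simp: left_ideal_of_eq_iff)
  finally have left: "left_ideal_of v = left_ideal_of (star u * m)" by simp
  have "v = u * (v * v)" "u = v * (u * u)"
    using uv vu by (simp_all add: mult.assoc[symmetric])
  then have "right_ideal_of v = right_ideal_of u" unfolding right_ideal_of_eq_iff by blast
  with left show ?thesis using uv by (simp add: is_core_inverse_def)
qed

text \<open>
  From \<open>b y b = b\<close> a right inverse of \<open>b\<close> yields \<open>b y = 1\<close>; since \<open>y R = b R = R\<close>, the element
  \<open>y\<close> has a right inverse as well, which must then be \<open>b\<close>.
\<close>

lemma core_inverse_of_right_invertible:
  fixes star :: "'a::{ring, monoid_mult} \<Rightarrow> 'a"
  assumes y: "is_core_inverse star m b y" and r: "b * r = 1"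
  shows "b * y = 1" and "y * b = 1"
proof -
  have "b * y * b = b" using y by (simp add: is_core_inverse_def)
  then show by1: "b * y = 1" using r by (metis mult.assoc mult_1_right)
  obtain t where "b = y * t"
    using y by (auto simp: is_core_inverse_def right_ideal_of_eq_iff)
  then have "y * (t * r) = 1" using r by (simp add: mult.assoc)
  then show "y * b = 1" using by1 by (metis mult.assoc mult_1_left mult_1_right)
qed

theorem theorem4p16:
  fixes star :: "'a::{ring, monoid_mult} \<Rightarrow> 'a" and m a b :: 'a
  assumes "involution star"
    and "ring_invertible m" and "star m = m"
    and "a \<in> core_invertible star m"
    and "b \<in> core_invertible star m"
    and "a * b \<in> core_invertible star m"
  shows "(unitary star b \<and>
            right_ideal_of (star b * core_inverse star m a) \<subseteq> right_ideal_of (core_inverse star m a)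
            \<longrightarrow> core_inverse star m (a * b) = star b * core_inverse star m a) \<and>
         (unitary star a \<and> right_ideal_of a \<subseteq> right_ideal_of b
            \<longrightarrow> core_inverse star m (a * b) = core_inverse star m b * star a)"
proof (intro conjI impI; elim conjE)
  note core = is_core_inverse_core_inverse[OF assms(1-3)]
  assume "unitary star b"
    and "right_ideal_of (star b * core_inverse star m a) \<subseteq> right_ideal_of (core_inverse star m a)"
  then show "core_inverse star m (a * b) = star b * core_inverse star m a"
    by (intro core_inverse_eqI[OF assms(1-3)]
        is_core_inverse_mult_unitary_right[OF assms(1-3) core[OF assms(4)] core[OF assms(6)]])
next
  let ?y = "core_inverse star m b"
  assume "unitary star a" and sub: "right_ideal_of a \<subseteq> right_ideal_of b"
  then have a1: "a * star a = 1" and a2: "star a * a = 1" by (auto simp: unitary_def)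
  obtain r where "a = b * r" using sub by (auto simp: right_ideal_of_subset_iff)
  then have "b * (r * star a) = 1" using a1 by (simp add: mult.assoc)
  note y = core_inverse_of_right_invertible
    [OF is_core_inverse_core_inverse[OF assms(1-3) assms(5)] this]
  have "a * b * (?y * star a) = a * (b * ?y) * star a"
    and "?y * star a * (a * b) = ?y * (star a * a) * b"
    by (simp_all only: mult.assoc)
  then have "a * b * (?y * star a) = 1" and "?y * star a * (a * b) = 1"
    using y a1 a2 by simp_all
  then show "core_inverse star m (a * b) = ?y * star a"
    by (intro core_inverse_eqI[OF assms(1-3)] is_core_inverse_unit[OF assms(1,2)])
qed

end
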